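(* Let $p$ be a prime number, let $0<l\le r$ be integers, and let $\lambda_l,\ldots,\lambda_r\in\mathbb{Z}_{p^2}$ satisfy $\gcd(p,\lambda_r)=1$ and $p\mid\lambda_i$ for all $i\neq r$, $l\le i\le r$. Let $T_{f[l,r]}:\mathbb{Z}_{p^2}^{\mathbb{Z}}\to\mathbb{Z}_{p^2}^{\mathbb{Z}}$ be the (invertible) one-dimensional linear cellular automaton with local rule $f(x_l,\ldots,x_r)=\sum_{i=l}^{r}\lambda_i x_i \pmod{p^2}$, and let $T_{g[-(2r-l),-r]}=T_{f[l,r]}^{-1}$ be its inverse, the linear cellular automaton with local rule $g$. Then both $T_{f[l,r]}$ and $T_{g[-(2r-l),-r]}$ are strong mixing with respect to the uniform Bernoulli measure $\mu$ on $\mathbb{Z}_{p^2}^{\mathbb{Z}}$.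
   Context: For $m\ge 2$, $\mathbb{Z}_m=\{0,\ldots,m-1\}$ is the ring of integers modulo $m$, and $\mathbb{Z}_m^{\mathbb{Z}}$ is the space of doubly-infinite sequences $x=(x_n)_{n\in\mathbb{Z}}$, with the product topology and Borel $\sigma$-algebra $\mathcal{B}$. For a linear local rule $f(x_l,\ldots,x_r)=\sum_{i=l}^r\lambda_i x_i \pmod m$, the linear cellular automaton $T_{f[l,r]}$ is defined by $(T_{f[l,r]}x)_n=\sum_{i=l}^r\lambda_i x_{n+i}\pmod m$ for all $n\in\mathbb{Z}$. Under the divisibility hypotheses of the claim (with $m=p^2$), $T_{f[l,r]}$ is invertible and its inverse is a linear cellular automaton $T_{g[-(2r-l),-r]}$ whose local rule has the form $g(x_{-(2r-l)},\ldots,x_{-r})=-p\sum_{i=-(2r-l)}^{-r}\gamma_i x_i+\lambda_r^{-1}x_{-r}\pmod{p^2}$ with $\gamma_i\in\mathbb{Z}_{p^2}$. The uniform Bernoulli measure $\mu$ is the Borel probability measure with $\mu(\{x: x_a=j_0,\ldots,x_{a+s}=j_s\})=m^{-(s+1)}$ for all $a\in\mathbb{Z}$, $s\ge 0$, $j_0,\ldots,j_s\in\mathbb{Z}_m$. A measure-preserving transformation $T$ of a probability space $(X,\mathcal{B},\mu)$ is strong mixing if $\lim_{n\to\infty}\mu(T^{-n}A\cap B)=\mu(A)\mu(B)$ for all $A,B\in\mathcal{B}$. *)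

theory Defs
  imports "HOL-Probability.Probability" "HOL-Number_Theory.Number_Theory"
begin

text \<open>
  The ring of integers modulo \<open>m\<close> is represented by the set of residues \<open>{0..<m}\<close> of integers,
  with arithmetic followed by reduction \<open>mod m\<close>.
\<close>

definition Zmod :: "int \<Rightarrow> int set" where
  "Zmod m = {0..<m}"

definition seq_topology :: "int \<Rightarrow> (int \<Rightarrow> int) topology" where
  "seq_topology m = product_topology (\<lambda>_. discrete_topology (Zmod m)) UNIV"

abbreviation seq_space :: "int \<Rightarrow> (int \<Rightarrow> int) set" where
  "seq_space m \<equiv> topspace (seq_topology m)"

text \<open>
  A local rule is a function of a whole configuration \<open>y\<close>; the rule with coefficients \<open>\<lambda>\<^sub>l,\<dots>,\<lambda>\<^sub>r\<close>
  depends only on the coordinates \<open>y\<^sub>l,\<dots>,y\<^sub>r\<close>.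
\<close>

definition linear_rule :: "int \<Rightarrow> int \<Rightarrow> int \<Rightarrow> (int \<Rightarrow> int) \<Rightarrow> (int \<Rightarrow> int) \<Rightarrow> int" where
  "linear_rule m l r lam y = (\<Sum>i\<in>{l..r}. lam i * y i) mod m"

definition cellular_automaton :: "((int \<Rightarrow> int) \<Rightarrow> int) \<Rightarrow> (int \<Rightarrow> int) \<Rightarrow> (int \<Rightarrow> int)" where
  "cellular_automaton f x = (\<lambda>n. f (\<lambda>i. x (n + i)))"

text \<open>\<open>sigma\<close> applied to the family of open sets is the Borel \<open>\<sigma>\<close>-algebra.\<close>

definition uniform_bernoulli :: "int \<Rightarrow> (int \<Rightarrow> int) measure \<Rightarrow> bool" where
  "uniform_bernoulli m M \<longleftrightarrow>
     prob_space M \<and>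
     space M = seq_space m \<and>
     sets M = sets (sigma (seq_space m) {U. openin (seq_topology m) U}) \<and>
     (\<forall>(a::int) (s::nat) (j :: nat \<Rightarrow> int). (\<forall>k\<le>s. j k \<in> Zmod m) \<longrightarrow>
        measure M {x \<in> seq_space m. \<forall>k\<le>s. x (a + int k) = j k} = 1 / real_of_int m ^ (s + 1))"

definition strong_mixing :: "'a measure \<Rightarrow> ('a \<Rightarrow> 'a) \<Rightarrow> bool" where
  "strong_mixing M T \<longleftrightarrow>
     T \<in> measurable M M \<and> distr M M T = M \<and>
     (\<forall>A\<in>sets M. \<forall>B\<in>sets M.
        (\<lambda>n. measure M (((T ^^ n) -` A \<inter> space M) \<inter> B)) \<longlonglongrightarrow> measure M A * measure M B)"

text \<open>The predicate \<open>uniform_bernoulli\<close> is satisfied by the product measure.\<close>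

lemma topspace_seq: "seq_space m = PiE UNIV (\<lambda>_. Zmod m)"
  by (simp add: seq_topology_def)

lemma sets_PiM_eq_borel:
  "sets (PiM UNIV (\<lambda>_::int. uniform_count_measure (Zmod m))) =
   sets (sigma (seq_space m) {U. openin (seq_topology m) U})" (is "sets ?P = sets ?S")
proof -
  have fin: "finite (Zmod m)" by (simp add: Zmod_def)
  have spP: "space ?P = seq_space m"
    by (simp add: topspace_seq space_PiM space_uniform_count_measure)
  have setsS: "sets ?S = sigma_sets (seq_space m) {U. openin (seq_topology m) U}"
    by (rule sets_measure_of) (auto dest: openin_subset)
  have 1: "U \<in> sets ?P" if U: "openin (seq_topology m) U" for U
  proof -
    define cyl where "cyl = (\<lambda>(F::int set, w). {x \<in> seq_space m. \<forall>i\<in>F. x i = (w i :: int)})"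
    define I where "I = Sigma {F::int set. finite F} (\<lambda>F. PiE F (\<lambda>_. Zmod m))"
    have cI: "countable I"
      unfolding I_def using fin
      by (intro countable_SIGMA) (auto intro!: countable_finite finite_PiE countable_Collect_finite)
    have cyl: "cyl q \<in> sets ?P" if qI: "q \<in> I" for q
    proof -
      obtain F w where q: "q = (F, w)" "finite F" "w \<in> PiE F (\<lambda>_. Zmod m)"
        using qI by (cases q) (auto simp: I_def)
      have "cyl q = prod_emb UNIV (\<lambda>_. uniform_count_measure (Zmod m)) F (PiE F (\<lambda>i. {w i}))"
        using q by (auto simp: cyl_def prod_emb_def topspace_seq space_uniform_count_measure PiE_iff extensional_def)
      also have "\<dots> \<in> sets ?P"
        using q by (intro sets_PiM_I) (auto simp: sets_uniform_count_measure PiE_iff)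
      finally show ?thesis .
    qed
    have "U = (\<Union>q\<in>{q\<in>I. cyl q \<subseteq> U}. cyl q)"
    proof (intro equalityI subsetI)
      fix x assume x: "x \<in> U"
      then obtain V where V: "finite {i. V i \<noteq> Zmod m}" "x \<in> PiE UNIV V" "PiE UNIV V \<subseteq> U"
        using U unfolding seq_topology_def openin_product_topology_alt by auto
      have xs: "x \<in> seq_space m" using x U openin_subset by blast
      define F where "F = {i. V i \<noteq> Zmod m}"
      let ?q = "(F, restrict x F)"
      have "?q \<in> I" using V xs by (auto simp: I_def F_def topspace_seq PiE_iff)
      moreover have "cyl ?q \<subseteq> PiE UNIV V"
      proof
        fix y assume y: "y \<in> cyl ?q"
        have "y i \<in> V i" for i
          using y V(2) by (cases "i \<in> F") (auto simp: cyl_def F_def topspace_seq PiE_iff)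
        then show "y \<in> PiE UNIV V" by auto
      qed
      moreover have "x \<in> cyl ?q" using xs by (auto simp: cyl_def)
      ultimately show "x \<in> (\<Union>q\<in>{q\<in>I. cyl q \<subseteq> U}. cyl q)" using V(3) by blast
    qed auto
    moreover have "countable {q\<in>I. cyl q \<subseteq> U}"
      by (rule countable_subset[OF _ cI]) auto
    ultimately show ?thesis
      using cyl by (metis (no_types, lifting) mem_Collect_eq sets.countable_UN'')
  qed
  have 2: "{f\<in>PiE UNIV (\<lambda>_::int. Zmod m). f i \<in> A} \<in> sets ?S" if "A \<subseteq> Zmod m" for i A
  proof -
    have "openin (seq_topology m) (PiE UNIV (\<lambda>k. if k = i then A else Zmod m))"
      unfolding seq_topology_def openin_PiE_gen
      using that by (auto intro: rev_finite_subset[of "{i}"])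
    moreover have "{f\<in>PiE UNIV (\<lambda>_::int. Zmod m). f i \<in> A} = PiE UNIV (\<lambda>k. if k = i then A else Zmod m)"
      (is "?L = ?R")
    proof (intro equalityI subsetI)
      fix x assume x: "x \<in> ?R"
      have *: "x k \<in> (if k = i then A else Zmod m)" for k
        using x by blast
      have "x i \<in> A" using *[of i] by simp
      moreover have "x k \<in> Zmod m" for k
        using *[of k] that by (cases "k = i") auto
      ultimately show "x \<in> ?L" by auto
    qed auto
    ultimately show ?thesis unfolding setsS by auto
  qed
  show ?thesis
  proof
    have top: "PiE UNIV (\<lambda>_::int. Zmod m) \<in> sets ?S"
      unfolding setsS topspace_seq[symmetric] by (rule sigma_sets_top)
    show "sets ?P \<subseteq> sets ?S"
      unfolding sets_PiM_single space_uniform_count_measure sets_uniform_count_measure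
      using 2 by (intro sets.sigma_sets_subset'[OF _ top]) auto
    show "sets ?S \<subseteq> sets ?P"
      unfolding setsS using 1 sets.top[of ?P] unfolding spP by (intro sets.sigma_sets_subset') auto
  qed
qed

lemma uniform_bernoulli_PiM:
  assumes "m \<ge> 2"
  shows "uniform_bernoulli m (PiM UNIV (\<lambda>_. uniform_count_measure (Zmod m)))"
proof -
  let ?N = "uniform_count_measure (Zmod m)"
  have fin: "finite (Zmod m)" "Zmod m \<noteq> {}" "card (Zmod m) = nat m"
    using assms by (auto simp: Zmod_def)
  interpret N: prob_space ?N using fin by (intro prob_space_uniform_count_measure)
  interpret product_prob_space "\<lambda>_::int. ?N" UNIV ..
  have "measure (PiM UNIV (\<lambda>_. ?N)) {x \<in> seq_space m. \<forall>k\<le>s. x (a + int k) = j k}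
        = 1 / real_of_int m ^ (s + 1)" (is "measure _ ?C = _")
    if j: "\<forall>k\<le>s. j k \<in> Zmod m" for a s j
  proof -
    let ?J = "{a..a + int s}"
    have "?C = prod_emb UNIV (\<lambda>_. ?N) ?J (PiE ?J (\<lambda>i. {j (nat (i - a))}))"
    proof -
      have "(\<forall>k\<le>s. x (a + int k) = j k) \<longleftrightarrow> (\<forall>i\<in>?J. x i = j (nat (i - a)))" for x :: "int \<Rightarrow> int"
      proof safe
        fix i assume H: "\<forall>k\<le>s. x (a + int k) = j k" and i: "i \<in> ?J"
        then have "nat (i - a) \<le> s" "a + int (nat (i - a)) = i" by auto
        with H show "x i = j (nat (i - a))" by metis
      qed auto
      then show ?thesis
        by (auto simp: prod_emb_def topspace_seq space_uniform_count_measure PiE_iff)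
    qed
    also have "measure (PiM UNIV (\<lambda>_. ?N)) \<dots> = (\<Prod>i\<in>?J. measure ?N {j (nat (i - a))})"
      using j by (intro measure_PiM_emb) (auto simp: sets_uniform_count_measure)
    also have "\<dots> = (\<Prod>i\<in>?J. 1 / real_of_int m)"
      using j fin assms by (intro prod.cong refl) (subst measure_uniform_count_measure, auto)
    also have "\<dots> = 1 / real_of_int m ^ (s + 1)"
      by (simp add: power_divide nat_add_distrib)
    finally show ?thesis .
  qed
  then show ?thesis
    unfolding uniform_bernoulli_def
    by (intro conjI allI impI sets_PiM_eq_borel)
      (auto intro: P.prob_space_axioms simp: topspace_seq space_PiM space_uniform_count_measure)
qed

end

theory Submission
  imports Defs
begin

text \<open>
  Write \<open>T = \<lambda>\<^sub>r \<sigma>\<^sup>r + p S\<close>, where \<open>\<sigma>\<close> is the shift and \<open>S = \<Sum>\<^sub>i\<^sub><\<^sub>r (\<lambda>\<^sub>i / p) \<sigma>\<^sup>i\<close>, and let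
  \<open>u\<close> be the inverse of \<open>\<lambda>\<^sub>r\<close>. Since \<open>p\<^sup>2 = 0\<close>, the inverse of \<open>T\<close> is
  \<open>u \<sigma>\<^sup>-\<^sup>r - p u\<^sup>2 \<sigma>\<^sup>-\<^sup>2\<^sup>r S\<close>, which gives the coefficients \<open>\<gamma>\<close>.
  The uniform measure is the Haar measure of the group \<open>\<int>\<^sub>m\<^sup>\<int>\<close>, so it is preserved by the surjective
  endomorphism \<open>T\<close>, and hence by its inverse.
  As \<open>l > 0\<close>, the \<open>n\<close>-th iterate evaluated on a fixed window reads only coordinates \<open>\<ge> n + const\<close>;
  so for large \<open>n\<close> the preimage of a cylinder is invariant under all translations supported in a
  given window, and is therefore independent of every cylinder over that window. Cylinders over
  symmetric windows are a generating \<open>\<pi>\<close>-system, and mixing extends from them to all Borel sets.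
  The inverse is treated in the same way, with left and right exchanged.
\<close>

section \<open>Mixing from a generating pi-system\<close>

lemma distr_funpow:
  assumes "T \<in> measurable M M" "distr M M T = M"
  shows "distr M M (T ^^ n) = M"
proof (induction n)
  case (Suc n)
  have "distr M M (T ^^ Suc n) = distr (distr M M (T ^^ n)) M T"
    by (simp add: distr_distr[OF assms(1) measurable_compose_n[OF assms(1)]] o_def)
  then show ?case using Suc assms(2) by metis
qed (simp add: id_def distr_id)

text \<open>Two successive Dynkin inductions extend the limit: first in \<open>B\<close> with
  \<open>A\<close> in \<open>G\<close> fixed, then in \<open>A\<close> with \<open>B\<close> an
  arbitrary measurable set. Complements follow by subtraction; countable disjoint unions need an
  exchange of limit and series.\<close>

lemma (in prob_space) strong_mixing_if_Int_stable:
  assumes T: "T \<in> measurable M M" "distr M M T = M"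
    and G: "Int_stable G" "G \<subseteq> Pow (space M)" "sets M = sigma_sets (space M) G"
    and mix: "\<And>A B. A \<in> G \<Longrightarrow> B \<in> G \<Longrightarrow>
      (\<lambda>n. measure M (((T ^^ n) -` A \<inter> space M) \<inter> B)) \<longlonglongrightarrow> measure M A * measure M B"
  shows "strong_mixing M T"
proof -
  define P where "P n A = (T ^^ n) -` A \<inter> space M" for n A
  note Tn = measurable_compose_n[OF T(1)]
  have sP [measurable]: "P n A \<in> sets M" if "A \<in> sets M" for n A
    unfolding P_def using Tn that by (rule measurable_sets)
  have mP: "prob (P n A) = prob A" if "A \<in> sets M" for n A
    unfolding P_def using measure_distr[OF Tn[of n] that] distr_funpow[OF T] by simp
  have PC: "P n (space M - A) = space M - P n A" for n A
    using measurable_space[OF Tn] by (auto simp: P_def)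
  define lim where
    "lim A B \<longleftrightarrow> (\<lambda>n. prob (P n A \<inter> B)) \<longlonglongrightarrow> prob A * prob B" for A B
  \<comment> \<open>Serves both inductions: one of the families \<open>A\<close>, \<open>B\<close>
    is constant, the other disjoint. The masses of the disjoint family \<open>C\<close> form a
    summable majorant uniform in \<open>n\<close>, so Tannery's theorem exchanges limit and
    sum.\<close>
  have limI: "lim (\<Union>i. A i) (\<Union>i. B i)"
    if A: "range A \<subseteq> sets M" and B: "range B \<subseteq> sets M" and C: "range C \<subseteq> sets M"
      and disj: "\<And>i j. i \<noteq> j \<Longrightarrow> A i \<inter> A j = {} \<or> B i \<inter> B j = {}" "disjoint_family C"
      and AB: "\<And>i. lim (A i) (B i)" "\<And>i n. prob (P n (A i) \<inter> B i) \<le> prob (C i)"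
      and UN: "\<And>n. P n (\<Union>i. A i) \<inter> (\<Union>i. B i) = (\<Union>i. P n (A i) \<inter> B i)"
        "(\<lambda>i. prob (A i) * prob (B i)) sums (prob (\<Union>i. A i) * prob (\<Union>i. B i))"
    for A B C :: "nat \<Rightarrow> 'a set"
  proof -
    have 1: "prob (P n (\<Union>i. A i) \<inter> (\<Union>i. B i)) = (\<Sum>i. prob (P n (A i) \<inter> B i))" for n
    proof -
      have "disjoint_family (\<lambda>i. P n (A i) \<inter> B i)"
        using disj(1) by (fastforce simp: disjoint_family_on_def P_def)
      then show ?thesis
        unfolding UN(1) using A B sP
        by (intro sums_unique finite_measure_UNION) (auto simp: image_subset_iff)
    qed
    have "((\<lambda>n. \<Sum>i. prob (P n (A i) \<inter> B i)) \<longlongrightarrow> (\<Sum>i. prob (A i) * prob (B i))) sequentially"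
      using AB sums_summable[OF finite_measure_UNION[OF C disj(2)]] unfolding lim_def
      by (intro tannerys_theorem[where M = "\<lambda>i. prob (C i)", THEN conjunct2, THEN conjunct2])
        (auto simp: case_prod_unfold)
    then show ?thesis
      unfolding lim_def 1 using sums_unique[OF UN(2)] by simp
  qed
  have GB: "lim A B" if "A \<in> G" and B: "B \<in> sigma_sets (space M) G" for A B
    using G(1,2) B
  proof (induction rule: sigma_sets_induct_disjoint)
    case (basic B)
    then show ?case using mix[OF \<open>A \<in> G\<close>] by (simp add: lim_def P_def)
  next
    case empty
    then show ?case by (simp add: lim_def)
  next
    case (compl B)
    have AB: "A \<in> sets M" "B \<in> sets M" using G(3) compl(1) \<open>A \<in> G\<close> by auto
    have "prob (P n A \<inter> (space M - B)) = prob A - prob (P n A \<inter> B)" for n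
    proof -
      have "P n A \<inter> (space M - B) = P n A - P n A \<inter> B"
        by (auto simp: P_def)
      then show ?thesis
        using AB sP[OF AB(1), of n] finite_measure_Diff[of "P n A" "P n A \<inter> B"] by (simp add: mP)
    qed
    then show ?case
      using tendsto_diff[OF tendsto_const[of "prob A"] compl(2)[unfolded lim_def]] AB
      unfolding lim_def by (simp add: prob_compl right_diff_distrib left_diff_distrib)
  next
    case (union B)
    have A: "A \<in> sets M" and B: "range B \<subseteq> sets M" using G(3) union \<open>A \<in> G\<close> by auto
    have "lim (\<Union>i::nat. A) (\<Union>i. B i)"
      using A B union sums_mult[OF finite_measure_UNION[OF B union(1)], of "prob A"]
      by (intro limI[of _ B B])
        (auto simp: disjoint_family_on_def image_subset_iff intro!: finite_measure_mono)
    then show ?case by simp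
  qed
  have "lim A B" if A: "A \<in> sigma_sets (space M) G" and "B \<in> sets M" for A B
    using G(1,2) A
  proof (induction rule: sigma_sets_induct_disjoint)
    case (basic A)
    then show ?case using GB \<open>B \<in> sets M\<close> G(3) by simp
  next
    case empty
    then show ?case by (simp add: lim_def P_def)
  next
    case (compl A)
    have AB: "A \<in> sets M" "B \<in> sets M" using G(3) compl(1) \<open>B \<in> sets M\<close> by auto
    have "prob (P n (space M - A) \<inter> B) = prob B - prob (P n A \<inter> B)" for n
    proof -
      have "P n (space M - A) \<inter> B = B - P n A \<inter> B"
        using sets.sets_into_space[OF AB(2)] unfolding PC by auto
      then show ?thesis
        using AB sP[OF AB(1), of n] finite_measure_Diff[of B "P n A \<inter> B"] by simp
    qed
    then show ?case
      using tendsto_diff[OF tendsto_const[of "prob B"] compl(2)[unfolded lim_def]] AB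
      unfolding lim_def by (simp add: prob_compl right_diff_distrib left_diff_distrib)
  next
    case (union A)
    have A: "range A \<subseteq> sets M" using G(3) union by auto
    \<comment> \<open>Invariance of the measure makes this majorant independent of
      \<open>n\<close>.\<close>
    have "prob (P n (A i) \<inter> B) \<le> prob (A i)" for n i
      using A finite_measure_mono[of "P n (A i) \<inter> B" "P n (A i)"] mP[of "A i" n] sP[of "A i" n]
      by (auto simp: image_subset_iff)
    then have "lim (\<Union>i. A i) (\<Union>i::nat. B)"
      using A \<open>B \<in> sets M\<close> union sums_mult2[OF finite_measure_UNION[OF A union(1)], of "prob B"]
      by (intro limI[of A _ A])
        (auto simp: disjoint_family_on_def image_subset_iff P_def)
    then show ?case by simp
  qed
  then show ?thesis
    unfolding strong_mixing_def using T G(3) by (auto simp: lim_def P_def)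
qed

section \<open>Cylinders over symmetric windows\<close>

text \<open>The word \<open>w\<close> is arbitrary: if it takes values outside \<open>Zmod m\<close>, the cylinder is empty.
  This makes \<open>cyls m\<close> closed under intersection.\<close>

definition cyl :: "int \<Rightarrow> nat \<Rightarrow> (int \<Rightarrow> int) \<Rightarrow> (int \<Rightarrow> int) set" where
  "cyl m k w = {x \<in> seq_space m. \<forall>i. \<bar>i\<bar> < int k \<longrightarrow> x i = w i}"

definition cyls :: "int \<Rightarrow> (int \<Rightarrow> int) set set" where
  "cyls m = {cyl m k w |k w. True}"

text \<open>Words are extensional, so there are finitely many of them and distinct words give
  disjoint cylinders.\<close>

definition words :: "int \<Rightarrow> nat \<Rightarrow> (int \<Rightarrow> int) set" where
  "words m k = PiE {i. \<bar>i\<bar> < int k} (\<lambda>_. Zmod m)"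

lemma seq_space_iff: "x \<in> seq_space m \<longleftrightarrow> (\<forall>i. 0 \<le> x i \<and> x i < m)"
  by (auto simp: topspace_seq Zmod_def PiE_iff)

lemma window_eq: "{i. \<bar>i\<bar> < int k} = {- int k<..<int k}"
  by auto

lemma finite_words: "finite (words m k)"
  unfolding words_def window_eq by (intro finite_PiE) (auto simp: Zmod_def)

text \<open>For \<open>k = 0\<close> the truncated exponent is 0, matching the single empty
  word.\<close>

lemma card_words: "m \<ge> 0 \<Longrightarrow> real (card (words m k)) = real_of_int m ^ (2 * k - 1)"
  unfolding words_def window_eq
  by (subst card_PiE) (auto simp: Zmod_def intro!: arg_cong[where f = "(^) _"])

lemma cyl_0 [simp]: "cyl m 0 w = seq_space m"
  by (simp add: cyl_def)

lemma cyl_subset: "cyl m k w \<subseteq> seq_space m"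
  by (auto simp: cyl_def)

lemma restrict_in_words:
  "x \<in> seq_space m \<Longrightarrow> restrict x {i. \<bar>i\<bar> < int k} \<in> words m k"
  by (auto simp: words_def seq_space_iff Zmod_def)

lemma cyl_restrict: "x \<in> seq_space m \<Longrightarrow> x \<in> cyl m k (restrict x {i. \<bar>i\<bar> < int k})"
  by (simp add: cyl_def)

lemma UN_cyl: "seq_space m = (\<Union>w\<in>words m k. cyl m k w)"
  using cyl_restrict restrict_in_words cyl_subset by blast

lemma disjoint_cyl: "disjoint_family_on (cyl m k) (words m k)"
  unfolding disjoint_family_on_def
proof (intro ballI impI)
  fix v w assume *: "v \<in> words m k" "w \<in> words m k" "v \<noteq> w"
  then obtain i where "\<bar>i\<bar> < int k" "v i \<noteq> w i"
    unfolding words_def by (metis (mono_tags, lifting) PiE_ext mem_Collect_eq)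
  then show "cyl m k v \<inter> cyl m k w = {}" by (auto simp: cyl_def)
qed

text \<open>Reduces an arbitrary \<open>w\<close> to a word over the alphabet, where cylinders can
  be counted and measured.\<close>

lemma cyl_eq_empty_or_word:
  obtains "cyl m k w = {}" | "restrict w {i. \<bar>i\<bar> < int k} \<in> words m k"
    "cyl m k w = cyl m k (restrict w {i. \<bar>i\<bar> < int k})"
proof (cases "cyl m k w = {}")
  case False
  then obtain x where "x \<in> seq_space m" "\<forall>i. \<bar>i\<bar> < int k \<longrightarrow> x i = w i" by (auto simp: cyl_def)
  then have "\<forall>i. \<bar>i\<bar> < int k \<longrightarrow> 0 \<le> w i \<and> w i < m" by (metis seq_space_iff)
  then show ?thesis
    by (intro that(2)) (auto simp: words_def Zmod_def cyl_def)
qed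

text \<open>Centred windows are nested. Either the two words agree on the smaller window and the
  cylinder over the larger one remains, or the intersection is empty.\<close>

lemma Int_stable_cyls: "Int_stable (cyls m)"
proof -
  have *: "cyl m k v \<inter> cyl m l w \<in> cyls m" if "k \<le> l" for k l v w
  proof (cases "\<forall>i. \<bar>i\<bar> < int k \<longrightarrow> v i = w i")
    case True
    then have "cyl m k v \<inter> cyl m l w = cyl m l w" using that by (auto simp: cyl_def)
    then show ?thesis by (auto simp: cyls_def)
  next
    case False
    then obtain i where "\<bar>i\<bar> < int k" "v i \<noteq> w i" by blast
    moreover from this(1) that have "\<bar>i\<bar> < int l" by simp
    ultimately have "cyl m k v \<inter> cyl m l w = {}"
      by (auto simp: cyl_def)
    \<comment> \<open>Since \<open>- 1\<close> is not a residue, this exhibits the empty set as a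
      cylinder.\<close>
    also have "\<dots> = cyl m 1 (\<lambda>_. - 1)"
    proof -
      have "x 0 \<noteq> - 1" if "x \<in> seq_space m" for x
        using that seq_space_iff[of x m] by (metis neg_0_le_iff_le not_one_le_zero)
      then show ?thesis by (auto simp: cyl_def)
    qed
    finally show ?thesis by (auto simp: cyls_def)
  qed
  show ?thesis
  proof (rule Int_stableI)
    fix A B assume "A \<in> cyls m" "B \<in> cyls m"
    then obtain k v l w where "A = cyl m k v" "B = cyl m l w" by (auto simp: cyls_def)
    then show "A \<inter> B \<in> cyls m"
      using *[of k l v w] *[of l k w v] by (cases "k \<le> l") (auto simp: Int_commute)
  qed
qed

lemma cyls_subset: "cyls m \<subseteq> Pow (seq_space m)"
  by (auto simp: cyls_def cyl_def)

text \<open>The alphabet is finite, so a set decided by the coordinates in a window is a finite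
  union of cylinders.\<close>

lemma window_set_in_sigma_cyls:
  assumes "E \<subseteq> seq_space m"
    and loc: "\<And>x y. x \<in> E \<Longrightarrow> y \<in> seq_space m \<Longrightarrow> (\<And>i. \<bar>i\<bar> < int k \<Longrightarrow> x i = y i) \<Longrightarrow> y \<in> E"
  shows "E \<in> sigma_sets (seq_space m) (cyls m)"
proof -
  interpret sigma_algebra "seq_space m" "sigma_sets (seq_space m) (cyls m)"
    by (rule sigma_algebra_sigma_sets[OF cyls_subset])
  have "E = (\<Union>w\<in>{w \<in> words m k. cyl m k w \<subseteq> E}. cyl m k w)"
  proof (intro equalityI subsetI)
    fix x assume x: "x \<in> E"
    define w where "w = restrict x {i. \<bar>i\<bar> < int k}"
    have "x \<in> seq_space m" using x assms(1) by blast
    then have "w \<in> words m k" "x \<in> cyl m k w"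
      unfolding w_def by (rule restrict_in_words, rule cyl_restrict)
    moreover have "cyl m k w \<subseteq> E"
      using loc[OF x] by (auto simp: cyl_def w_def)
    ultimately show "x \<in> (\<Union>w\<in>{w \<in> words m k. cyl m k w \<subseteq> E}. cyl m k w)" by blast
  qed auto
  moreover have "finite {w \<in> words m k. cyl m k w \<subseteq> E}"
    using finite_words by simp
  moreover have "cyl m k w \<in> sigma_sets (seq_space m) (cyls m)" for w
    by (rule sigma_sets.Basic) (auto simp: cyls_def)
  ultimately show ?thesis
    by (metis (no_types, lifting) finite_UN)
qed

text \<open>The comparison goes through the product sigma-algebra, which is already known to be the
  Borel one and is generated by single coordinates.\<close>

lemma sets_eq_sigma_cyls:
  "sets (sigma (seq_space m) {U. openin (seq_topology m) U}) = sigma_sets (seq_space m) (cyls m)"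
proof -
  let ?P = "PiM UNIV (\<lambda>_::int. uniform_count_measure (Zmod m))"
  have spP: "space ?P = seq_space m"
    by (simp add: topspace_seq space_PiM space_uniform_count_measure)
  have "sets ?P = sigma_sets (seq_space m) (cyls m)"
  proof
    show "sets ?P \<subseteq> sigma_sets (seq_space m) (cyls m)"
      unfolding sets_PiM_single space_uniform_count_measure sets_uniform_count_measure
        topspace_seq[symmetric]
    proof (rule sigma_sets_mono, safe)
      fix i :: int and A
      show "{f \<in> seq_space m. f i \<in> A} \<in> sigma_sets (seq_space m) (cyls m)"
        \<comment> \<open>Windows are strict, hence the \<open>+ 1\<close> to include coordinate
          \<open>i\<close>.\<close>
        by (rule window_set_in_sigma_cyls[where k = "nat (\<bar>i\<bar> + 1)"]) auto
    qed
  next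
    have "cyl m k w \<in> sets ?P" for k w
    proof -
      have "cyl m k w = {x \<in> space ?P. \<forall>i\<in>{- int k<..<int k}. x i \<in> {w i} \<inter> Zmod m}"
        unfolding spP cyl_def by (fastforce simp: topspace_seq PiE_iff)
      also have "\<dots> \<in> sets ?P"
        by (intro sets.sets_Collect_finite_All measurable_sets_Collect[OF measurable_component_singleton])
          (auto simp: sets_uniform_count_measure)
      finally show ?thesis .
    qed
    then show "sigma_sets (seq_space m) (cyls m) \<subseteq> sets ?P"
      unfolding spP[symmetric] by (intro sets.sigma_sets_subset) (auto simp: cyls_def)
  qed
  then show ?thesis using sets_PiM_eq_borel by simp
qed

section \<open>Translations and equidistribution over words\<close>

definition translate :: "int \<Rightarrow> (int \<Rightarrow> int) \<Rightarrow> (int \<Rightarrow> int) \<Rightarrow> (int \<Rightarrow> int)" where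
  "translate m z x = (\<lambda>i. (x i + z i) mod m)"

lemma mod_add_eq_iff:
  fixes a b z m :: int
  assumes "0 \<le> a" "a < m" "0 \<le> b" "b < m"
  shows "(a + z) mod m = b \<longleftrightarrow> a = (b - z) mod m"
proof
  assume "(a + z) mod m = b"
  then have "(b - z) mod m = ((a + z) - z) mod m" by (metis mod_diff_left_eq)
  then show "a = (b - z) mod m" using assms by simp
next
  assume "a = (b - z) mod m"
  then have "(a + z) mod m = ((b - z) + z) mod m" by (metis mod_add_left_eq)
  then show "(a + z) mod m = b" using assms by simp
qed

lemma translate_vimage_cyl:
  assumes "m > 0" and w: "\<And>i. \<bar>i\<bar> < int k \<Longrightarrow> w i \<in> Zmod m"
  shows "translate m z -` cyl m k w \<inter> seq_space m = cyl m k (\<lambda>i. (w i - z i) mod m)"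
proof -
  have "(x i + z i) mod m = w i \<longleftrightarrow> x i = (w i - z i) mod m"
    if "x \<in> seq_space m" "\<bar>i\<bar> < int k" for x i
    using that w[of i] by (intro mod_add_eq_iff) (auto simp: seq_space_iff Zmod_def)
  moreover have "translate m z x \<in> seq_space m" for x
    using \<open>m > 0\<close> by (simp add: seq_space_iff translate_def)
  ultimately show ?thesis
    unfolding cyl_def translate_def by blast
qed

text \<open>The cylinders over one window partition \<open>E\<close>; equal pieces therefore have
  mass \<open>measure N E\<close> divided by the number of words. The general \<open>N\<close>
  allows use for an image measure as well as for \<open>M\<close>.\<close>

lemma measure_cyl_Int_if_equidistributed:
  assumes "finite_measure N" and sN: "sets N = sigma_sets (seq_space m) (cyls m)"
    and E: "E \<in> sets N" and "m > 0"
    and eq: "\<And>v w. v \<in> words m k \<Longrightarrow> w \<in> words m k \<Longrightarrow>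
      measure N (cyl m k v \<inter> E) = measure N (cyl m k w \<inter> E)"
    and w: "w \<in> words m k"
  shows "measure N (cyl m k w \<inter> E) = measure N E / real_of_int m ^ (2 * k - 1)"
proof -
  interpret finite_measure N by fact
  have C: "cyl m k v \<in> sets N" for v
    unfolding sN by (rule sigma_sets.Basic) (auto simp: cyls_def)
  have "E \<subseteq> seq_space m"
    using E sigma_sets_into_sp[OF cyls_subset] unfolding sN by blast
  then have "E = (\<Union>v\<in>words m k. cyl m k v \<inter> E)"
    using UN_cyl[of m k] by blast
  then have "measure N E = measure N (\<Union>v\<in>words m k. cyl m k v \<inter> E)"
    by (rule arg_cong)
  also have "\<dots> = (\<Sum>v\<in>words m k. measure N (cyl m k v \<inter> E))"
  proof (rule finite_measure_finite_Union[OF finite_words])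
    show "(\<lambda>v. cyl m k v \<inter> E) ` words m k \<subseteq> sets N" using C E by blast
    show "disjoint_family_on (\<lambda>v. cyl m k v \<inter> E) (words m k)"
      using disjoint_cyl[of m k] unfolding disjoint_family_on_def by blast
  qed
  also have "\<dots> = (\<Sum>v\<in>words m k. measure N (cyl m k w \<inter> E))"
    by (rule sum.cong[OF refl eq[OF _ w]])
  also have "\<dots> = real_of_int m ^ (2 * k - 1) * measure N (cyl m k w \<inter> E)"
    using \<open>m > 0\<close> by (simp add: card_words)
  finally show ?thesis using \<open>m > 0\<close> by simp
qed

section \<open>Invariance and independence for the uniform Bernoulli measure\<close>

locale uniform_bernoulli_space = prob_space M for M :: "(int \<Rightarrow> int) measure" +
  fixes m :: int
  assumes bernoulli: "uniform_bernoulli m M"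
begin

lemma space_M: "space M = seq_space m"
  using bernoulli by (simp add: uniform_bernoulli_def)

lemma sets_M: "sets M = sigma_sets (seq_space m) (cyls m)"
  using bernoulli unfolding uniform_bernoulli_def sets_eq_sigma_cyls by blast

lemma cyl_in_sets [simp]: "cyl m k w \<in> sets M"
  unfolding sets_M by (rule sigma_sets.Basic) (auto simp: cyls_def)

lemma m_pos: "m > 0"
proof -
  obtain x where "x \<in> seq_space m" using not_empty space_M by blast
  then have "0 \<le> x 0" "x 0 < m" by (auto simp: seq_space_iff)
  then show ?thesis by simp
qed

lemma prob_cyl:
  assumes w: "\<And>i. \<bar>i\<bar> < int k \<Longrightarrow> w i \<in> Zmod m"
  shows "prob (cyl m k w) = 1 / real_of_int m ^ (2 * k - 1)"
proof (cases k)
  case 0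
  then show ?thesis using prob_space by (simp add: space_M)
next
  case (Suc s)
  \<comment> \<open>The window is the block of \<open>2 * s + 1\<close> coordinates starting at
    \<open>- int s\<close>. The empty window is treated separately because the defining blocks are
    nonempty.\<close>
  define j where "j i = w (- int s + int i)" for i
  have "(\<forall>i. \<bar>i\<bar> < int k \<longrightarrow> x i = w i) \<longleftrightarrow> (\<forall>i\<le>2 * s. x (- int s + int i) = j i)"
    for x :: "int \<Rightarrow> int"
  proof safe
    fix i :: int
    assume *: "\<forall>i\<le>2 * s. x (- int s + int i) = j i" and "\<bar>i\<bar> < int k"
    then have "nat (i + int s) \<le> 2 * s" "- int s + int (nat (i + int s)) = i"
      using Suc by auto
    with * show "x i = w i" unfolding j_def by metis
  qed (auto simp: j_def Suc)
  then have "cyl m k w = {x \<in> seq_space m. \<forall>i\<le>2 * s. x (- int s + int i) = j i}"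
    by (simp add: cyl_def)
  moreover have "\<forall>i\<le>2 * s. j i \<in> Zmod m"
    using w Suc by (auto simp: j_def)
  then have "prob {x \<in> seq_space m. \<forall>i\<le>2 * s. x (- int s + int i) = j i} =
      1 / real_of_int m ^ (2 * s + 1)"
    using bernoulli unfolding uniform_bernoulli_def by blast
  ultimately show ?thesis by (simp add: Suc)
qed

text \<open>Cylinders form a generating pi-system, so invariance of the measure only has to be
  tested on them.\<close>

lemma uniform_bernoulli_unique:
  assumes "prob_space N" and sN: "sets N = sets M"
    and cyl: "\<And>k w. w \<in> words m k \<Longrightarrow> measure N (cyl m k w) = 1 / real_of_int m ^ (2 * k - 1)"
  shows "N = M"
proof (rule measure_eqI_generator_eq[OF Int_stable_cyls cyls_subset])
  interpret N: prob_space N by fact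
  show "sets N = sigma_sets (seq_space m) (cyls m)" "sets M = sigma_sets (seq_space m) (cyls m)"
    using sN sets_M by auto
  show "range (\<lambda>_::nat. cyl m 0 w) \<subseteq> cyls m" for w
    unfolding cyls_def by blast
  show "(\<Union>i::nat. cyl m 0 w) = seq_space m" for w
    by simp
  show "emeasure N (cyl m 0 w) \<noteq> \<infinity>" for w
    by simp
  fix X assume "X \<in> cyls m"
  then obtain k w where X: "X = cyl m k w" by (auto simp: cyls_def)
  show "emeasure N X = emeasure M X"
  proof (cases rule: cyl_eq_empty_or_word[of m k w])
    case 1
    then show ?thesis by (simp add: X)
  next
    case 2
    let ?v = "restrict w {i. \<bar>i\<bar> < int k}"
    have "prob (cyl m k ?v) = 1 / real_of_int m ^ (2 * k - 1)"
      using 2(1) by (intro prob_cyl) (force simp: words_def PiE_iff)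
    then show ?thesis
      unfolding X 2(2) using cyl[OF 2(1)] by (simp add: N.emeasure_eq_measure emeasure_eq_measure)
  qed
qed

text \<open>If \<open>T\<close> has radius \<open>R\<close>, the preimage of a cylinder of radius
  \<open>k\<close> is decided by the window of radius \<open>k + R\<close>.\<close>

lemma measurable_if_local:
  assumes T: "T \<in> seq_space m \<rightarrow> seq_space m"
    and loc: "\<And>x y n. x \<in> seq_space m \<Longrightarrow> y \<in> seq_space m \<Longrightarrow>
      (\<And>i. \<bar>i - n\<bar> \<le> int R \<Longrightarrow> x i = y i) \<Longrightarrow> T x n = T y n"
  shows "T \<in> measurable M M"
proof (rule measurable_sigma_sets[OF sets_M cyls_subset])
  show "T \<in> space M \<rightarrow> seq_space m" using T space_M by simp
  fix X assume "X \<in> cyls m"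
  then obtain k w where X: "X = cyl m k w" by (auto simp: cyls_def)
  show "T -` X \<inter> space M \<in> sets M"
    unfolding sets_M space_M
  proof (rule window_set_in_sigma_cyls[where k = "k + R"])
    fix x y assume x: "x \<in> T -` X \<inter> seq_space m" and y: "y \<in> seq_space m"
      and xy: "\<And>i. \<bar>i\<bar> < int (k + R) \<Longrightarrow> x i = y i"
    have "T x n = T y n" if "\<bar>n\<bar> < int k" for n
      using x y xy that by (intro loc) auto
    then show "y \<in> T -` X \<inter> seq_space m"
      using x y T by (auto simp: X cyl_def)
  qed auto
qed

lemma translate_in_seq_space: "translate m z x \<in> seq_space m"
  using m_pos by (simp add: seq_space_iff translate_def)

lemma measurable_translate: "translate m z \<in> measurable M M"
  by (rule measurable_if_local[where R = 0]) (auto simp: translate_in_seq_space, simp add: translate_def)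

text \<open>The Haar property: a translation pulls a cylinder back to one over the same window, and
  these all have equal mass.\<close>

lemma distr_translate: "distr M M (translate m z) = M"
proof (rule uniform_bernoulli_unique)
  show "prob_space (distr M M (translate m z))"
    by (rule prob_space_distr[OF measurable_translate])
  fix k w assume w: "w \<in> words m k"
  have "measure (distr M M (translate m z)) (cyl m k w) = prob (translate m z -` cyl m k w \<inter> seq_space m)"
    by (simp add: measure_distr[OF measurable_translate] space_M)
  also have "\<dots> = prob (cyl m k (\<lambda>i. (w i - z i) mod m))"
    using m_pos w by (subst translate_vimage_cyl) (auto simp: words_def)
  also have "\<dots> = 1 / real_of_int m ^ (2 * k - 1)"
    using m_pos by (intro prob_cyl) (simp add: Zmod_def)
  finally show "measure (distr M M (translate m z)) (cyl m k w) = \<dots>" .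
qed simp

lemma prob_translate:
  assumes "E \<in> sets M"
  shows "prob (translate m z -` E \<inter> seq_space m) = prob E"
  using measure_distr[OF measurable_translate assms, of z] by (simp add: distr_translate space_M)

text \<open>Translations supported in the window act transitively on its cylinders. The support
  condition is what later fixes sets determined outside the window.\<close>

lemma ex_translate_cyl:
  assumes v: "v \<in> words m k" and w: "w \<in> words m k"
  obtains z where "z \<in> seq_space m" "\<And>i. \<bar>i\<bar> \<ge> int k \<Longrightarrow> z i = 0"
    "translate m z -` cyl m k w \<inter> seq_space m = cyl m k v"
proof
  let ?z = "\<lambda>i. if \<bar>i\<bar> < int k then (w i - v i) mod m else 0"
  show "?z \<in> seq_space m" using m_pos by (simp add: seq_space_iff)
  show "?z i = 0" if "\<bar>i\<bar> \<ge> int k" for i using that by simp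
  have "(w i - (w i - v i) mod m) mod m = v i" if "\<bar>i\<bar> < int k" for i
  proof -
    have "v i \<in> Zmod m" using v that by (auto simp: words_def)
    then show ?thesis by (simp add: Zmod_def mod_diff_right_eq)
  qed
  then have "cyl m k (\<lambda>i. (w i - ?z i) mod m) = cyl m k v"
    by (auto simp: cyl_def)
  then show "translate m ?z -` cyl m k w \<inter> seq_space m = cyl m k v"
    using m_pos w by (subst translate_vimage_cyl) (auto simp: words_def)
qed

text \<open>The image of Haar measure under a surjective endomorphism is again translation
  invariant, because every translation lifts through \<open>T\<close>. Hence the image measure gives
  equal mass to all cylinders over a window.\<close>

lemma distr_if_additive:
  assumes T: "T \<in> measurable M M" and surj: "T ` seq_space m = seq_space m"
    and add: "\<And>x z. x \<in> seq_space m \<Longrightarrow> z \<in> seq_space m \<Longrightarrow>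
      T (translate m z x) = translate m (T z) (T x)"
  shows "distr M M T = M"
proof (rule uniform_bernoulli_unique)
  let ?N = "distr M M T"
  show N: "prob_space ?N" by (rule prob_space_distr[OF T])
  interpret N: prob_space ?N by (rule N)
  fix k w assume w: "w \<in> words m k"
  \<comment> \<open>The intersection with the whole space matches the equidistribution lemma with
    \<open>E\<close> the full space.\<close>
  have N_cyl: "measure ?N (cyl m k v \<inter> seq_space m) = prob (T -` cyl m k v \<inter> seq_space m)" for v
    by (simp add: Int_absorb2[OF cyl_subset] measure_distr[OF T] space_M)
  have "measure ?N (cyl m k w \<inter> seq_space m) = measure ?N (seq_space m) / real_of_int m ^ (2 * k - 1)"
  proof (rule measure_cyl_Int_if_equidistributed[OF _ _ _ m_pos _ w])
    show "finite_measure ?N" by unfold_locales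
    show "sets ?N = sigma_sets (seq_space m) (cyls m)" by (simp add: sets_M)
    show "seq_space m \<in> sets ?N" by (simp add: space_M[symmetric])
    fix v w assume "v \<in> words m k" "w \<in> words m k"
    then obtain y where y: "y \<in> seq_space m"
      "translate m y -` cyl m k w \<inter> seq_space m = cyl m k v"
      by (rule ex_translate_cyl)
    then obtain z where z: "z \<in> seq_space m" "T z = y"
      using surj by (metis imageE)
    have Tx: "T x \<in> seq_space m" if "x \<in> seq_space m" for x
      using that surj by blast
    \<comment> \<open>By additivity, translating by \<open>z\<close> before \<open>T\<close> is
      translating by \<open>y\<close> after it.\<close>
    have "translate m z -` (T -` cyl m k w \<inter> seq_space m) \<inter> seq_space m = T -` cyl m k v \<inter> seq_space m"
      unfolding y(2)[symmetric] using z add Tx by (auto simp: translate_in_seq_space)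
    moreover have "T -` cyl m k w \<inter> seq_space m \<in> sets M"
      using measurable_sets[OF T cyl_in_sets] by (simp add: space_M)
    ultimately show "measure ?N (cyl m k v \<inter> seq_space m) = measure ?N (cyl m k w \<inter> seq_space m)"
      unfolding N_cyl using prob_translate[of "T -` cyl m k w \<inter> seq_space m" z] by metis
  qed
  then show "measure ?N (cyl m k w) = 1 / real_of_int m ^ (2 * k - 1)"
    using N.prob_space by (simp add: Int_absorb2[OF cyl_subset] space_M)
qed simp

text \<open>Translations supported in the window leave \<open>E\<close> invariant while permuting
  the cylinders, so \<open>E\<close> meets all of them in equal mass.\<close>

lemma prob_cyl_Int_outside:
  assumes E: "E \<in> sets M" and w: "w \<in> words m k"
    and out: "\<And>x y. x \<in> E \<Longrightarrow> y \<in> seq_space m \<Longrightarrow> (\<And>i. \<bar>i\<bar> \<ge> int k \<Longrightarrow> x i = y i) \<Longrightarrow> y \<in> E"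
  shows "prob (cyl m k w \<inter> E) = prob (cyl m k w) * prob E"
proof -
  have ES: "E \<subseteq> seq_space m" using sets.sets_into_space[OF E] space_M by simp
  have "prob (cyl m k w \<inter> E) = prob E / real_of_int m ^ (2 * k - 1)"
  proof (rule measure_cyl_Int_if_equidistributed[OF _ sets_M E m_pos _ w])
    show "finite_measure M" by unfold_locales
    fix v w assume "v \<in> words m k" "w \<in> words m k"
    then obtain z where z: "z \<in> seq_space m" "\<And>i. \<bar>i\<bar> \<ge> int k \<Longrightarrow> z i = 0"
      "translate m z -` cyl m k w \<inter> seq_space m = cyl m k v"
      using ex_translate_cyl by metis
    have same: "x i = translate m z x i" if "x \<in> seq_space m" "\<bar>i\<bar> \<ge> int k" for x i
      using that z(2) by (simp add: translate_def seq_space_iff)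
    have "translate m z x \<in> E \<longleftrightarrow> x \<in> E" if x: "x \<in> seq_space m" for x
      using out[of x "translate m z x"] out[of "translate m z x" x] same[OF x] x
        translate_in_seq_space by metis
    then have "translate m z -` (cyl m k w \<inter> E) \<inter> seq_space m = cyl m k v \<inter> E"
      unfolding z(3)[symmetric] using ES by auto
    then show "prob (cyl m k v \<inter> E) = prob (cyl m k w \<inter> E)"
      using prob_translate[of "cyl m k w \<inter> E" z] sets.Int[OF cyl_in_sets E] by simp
  qed
  moreover have "prob (cyl m k w) = 1 / real_of_int m ^ (2 * k - 1)"
    using w by (intro prob_cyl) (auto simp: words_def)
  ultimately show ?thesis by simp
qed

text \<open>Once the iterate on window \<open>k\<close> ignores the coordinates in window
  \<open>l\<close>, the two cylinder events are exactly independent. The correlations are thus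
  eventually constant.\<close>

lemma strong_mixing_if_forgets_windows:
  assumes T: "T \<in> measurable M M" "distr M M T = M"
    and forget: "\<And>k l. eventually (\<lambda>n. \<forall>x\<in>seq_space m. \<forall>y\<in>seq_space m.
      (\<forall>i. \<bar>i\<bar> \<ge> int l \<longrightarrow> x i = y i) \<longrightarrow>
      (\<forall>i. \<bar>i\<bar> < int k \<longrightarrow> (T ^^ n) x i = (T ^^ n) y i)) sequentially"
  shows "strong_mixing M T"
proof (rule strong_mixing_if_Int_stable[OF T Int_stable_cyls[of m]])
  show "cyls m \<subseteq> Pow (space M)" "sets M = sigma_sets (space M) (cyls m)"
    using cyls_subset sets_M by (auto simp: space_M)
  note Tn = measurable_compose_n[OF T(1)]
  fix A B assume "A \<in> cyls m" "B \<in> cyls m"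
  then obtain k v l w where A: "A = cyl m k v" and B: "B = cyl m l w"
    by (auto simp: cyls_def)
  let ?P = "\<lambda>n. (T ^^ n) -` A \<inter> space M"
  show "(\<lambda>n. prob (?P n \<inter> B)) \<longlonglongrightarrow> prob A * prob B"
  proof (cases rule: cyl_eq_empty_or_word[of m l w])
    case 1
    then show ?thesis by (simp add: B)
  next
    case 2
    let ?w = "restrict w {i. \<bar>i\<bar> < int l}"
    have "\<forall>\<^sub>F n in sequentially. prob (?P n \<inter> B) = prob A * prob B"
      using forget[of l k]
    proof eventually_elim
      case (elim n)
      have sP: "?P n \<in> sets M" using Tn by (rule measurable_sets) (simp add: A)
      have "prob (cyl m l ?w \<inter> ?P n) = prob (cyl m l ?w) * prob (?P n)"
      proof (rule prob_cyl_Int_outside[OF sP 2(1)])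
        fix x y assume x: "x \<in> ?P n" and y: "y \<in> seq_space m"
          and "\<And>i. \<bar>i\<bar> \<ge> int l \<Longrightarrow> x i = y i"
        then have "\<forall>i. \<bar>i\<bar> < int k \<longrightarrow> (T ^^ n) x i = (T ^^ n) y i"
          using elim unfolding space_M by blast
        moreover have "(T ^^ n) y \<in> seq_space m"
          using measurable_space[OF Tn] y by (simp add: space_M)
        ultimately show "y \<in> ?P n"
          using x y by (auto simp: A cyl_def space_M)
      qed
      moreover have "prob (?P n) = prob A"
        using measure_distr[OF Tn, of A n] distr_funpow[OF T, of n] by (simp add: A)
      ultimately show ?case
        unfolding B 2(2) by (simp add: Int_commute mult.commute)
    qed
    then show ?thesis by (rule tendsto_eventually)
  qed
qed

end

section \<open>Algebra of the inverse modulo the square of \<open>p\<close>\<close>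

text \<open>Behind a factor \<open>p\<close>, only residues modulo \<open>p\<close> matter.\<close>

lemma cong_mult_square_modulus:
  fixes p a b :: int
  assumes "[a = b] (mod p)"
  shows "[p * a = p * b] (mod p\<^sup>2)"
proof -
  have "p * p dvd p * (a - b)"
    using assms by (intro mult_dvd_mono) (auto simp: cong_iff_dvd_diff)
  then show ?thesis by (simp add: cong_iff_dvd_diff power2_eq_square right_diff_distrib)
qed

text \<open>Modulo \<open>p\<close>, \<open>F\<close> and \<open>G\<close> are scaled shifts, with
  which \<open>S\<close> commutes. So the composed terms carrying \<open>p * S\<close> simplify, and
  the remaining first-order terms cancel by \<open>uL\<close>.\<close>

lemma inverse_linear_automaton:
  fixes p l r L u :: int and a :: "int \<Rightarrow> int"
  defines "S \<equiv> \<lambda>x n. \<Sum>i\<in>{l..r}. a i * x (n + i)"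
  assumes uL: "[u * L = 1] (mod p\<^sup>2)"
    and F: "\<And>x n. [F x n = L * x (n + r) + p * S x n] (mod p\<^sup>2)"
    and G: "\<And>x n. [G x n = u * x (n - r) - p * (u\<^sup>2 * S x (n - 2 * r))] (mod p\<^sup>2)"
  shows "[G (F x) n = x n] (mod p\<^sup>2)" "[F (G x) n = x n] (mod p\<^sup>2)"
proof -
  have pp: "p dvd p\<^sup>2" by simp
  have S_scale: "[S y n = c * S x (n + k)] (mod p)" if "\<And>n. [y n = c * x (n + k)] (mod p)" for x y n c k
  proof -
    have "[S y n = (\<Sum>i\<in>{l..r}. a i * (c * x (n + i + k)))] (mod p)"
      unfolding S_def by (intro cong_sum cong_mult cong_refl that)
    also have "(\<Sum>i\<in>{l..r}. a i * (c * x (n + i + k))) = c * S x (n + k)"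
      by (simp add: S_def sum_distrib_left algebra_simps)
    finally show ?thesis .
  qed
  have "[F x n = L * x (n + r)] (mod p)" for n
    using cong_trans[OF cong_dvd_modulus[OF F pp], of _ _ "L * x (n + r)"]
    by (simp add: cong_iff_dvd_diff)
  then have SF: "[p * S (F x) n = p * (L * S x (n + r))] (mod p\<^sup>2)" for n
    by (intro cong_mult_square_modulus S_scale)
  have "[G x n = u * x (n + - r)] (mod p)" for n
    using cong_trans[OF cong_dvd_modulus[OF G pp], of _ _ "u * x (n + - r)"]
    by (simp add: cong_iff_dvd_diff)
  then have SG: "[p * S (G x) n = p * (u * S x (n + - r))] (mod p\<^sup>2)" for n
    by (intro cong_mult_square_modulus S_scale)
  have "[G (F x) n = u * F x (n - r) - u\<^sup>2 * (p * S (F x) (n - 2 * r))] (mod p\<^sup>2)"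
    using G[of "F x" n] by (simp add: mult.left_commute)
  also have "[u * F x (n - r) - u\<^sup>2 * (p * S (F x) (n - 2 * r)) =
      u * (L * x n + p * S x (n - r)) - u\<^sup>2 * (p * (L * S x (n - r)))] (mod p\<^sup>2)"
    using F[of x "n - r"] SF[of "n - 2 * r"]
    by (intro cong_diff[OF cong_scalar_left cong_scalar_left]) simp_all
  also have "[u * (L * x n + p * S x (n - r)) - u\<^sup>2 * (p * (L * S x (n - r))) = x n] (mod p\<^sup>2)"
  proof -
    \<comment> \<open>The error factors through \<open>u * L - 1\<close>, which the modulus divides;
      the other composition leaves the same error.\<close>
    have "u * (L * x n + p * S x (n - r)) - u\<^sup>2 * (p * (L * S x (n - r))) - x n
        = (u * L - 1) * (x n - u * p * S x (n - r))"
      by (simp add: algebra_simps power2_eq_square)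
    then show ?thesis
      using uL unfolding cong_iff_dvd_diff by (metis dvd_mult2)
  qed
  finally show "[G (F x) n = x n] (mod p\<^sup>2)" .
  have "[F (G x) n = L * G x (n + r) + p * S (G x) n] (mod p\<^sup>2)"
    by (rule F)
  also have "[L * G x (n + r) + p * S (G x) n =
      L * (u * x n - p * (u\<^sup>2 * S x (n - r))) + p * (u * S x (n - r))] (mod p\<^sup>2)"
    using G[of x "n + r"] SG[of n]
    by (intro cong_add[OF cong_scalar_left]) simp_all
  also have "[L * (u * x n - p * (u\<^sup>2 * S x (n - r))) + p * (u * S x (n - r)) = x n] (mod p\<^sup>2)"
  proof -
    have "L * (u * x n - p * (u\<^sup>2 * S x (n - r))) + p * (u * S x (n - r)) - x n
        = (u * L - 1) * (x n - u * p * S x (n - r))"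
      by (simp add: algebra_simps power2_eq_square)
    then show ?thesis
      using uL unfolding cong_iff_dvd_diff by (metis dvd_mult2)
  qed
  finally show "[F (G x) n = x n] (mod p\<^sup>2)" .
qed

text \<open>Linearity of the rule makes the automaton a group endomorphism, as required by
  \<open>distr_if_additive\<close>.\<close>

lemma linear_automaton_translate:
  "cellular_automaton (linear_rule m l r lam) (translate m z x) =
   translate m (cellular_automaton (linear_rule m l r lam) z)
     (cellular_automaton (linear_rule m l r lam) x)"
proof
  fix n
  have "[(\<Sum>i\<in>{l..r}. lam i * ((x (n + i) + z (n + i)) mod m)) =
      (\<Sum>i\<in>{l..r}. lam i * (x (n + i) + z (n + i)))] (mod m)"
    by (intro cong_sum cong_mult cong_refl) (simp add: cong_def)
  then show "cellular_automaton (linear_rule m l r lam) (translate m z x) n =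
   translate m (cellular_automaton (linear_rule m l r lam) z)
     (cellular_automaton (linear_rule m l r lam) x) n"
    by (simp add: cellular_automaton_def linear_rule_def translate_def cong_def
        distrib_left sum.distrib mod_add_eq)
qed

section \<open>Mixing of one-sided cellular automata\<close>

context uniform_bernoulli_space
begin

lemma measurable_cellular_automaton:
  assumes range: "\<And>y. f y \<in> Zmod m"
    and dep: "\<And>x y. (\<And>i. c \<le> i \<Longrightarrow> i \<le> d \<Longrightarrow> x i = y i) \<Longrightarrow> f x = f y"
  shows "cellular_automaton f \<in> measurable M M"
proof (rule measurable_if_local[where R = "nat (max \<bar>c\<bar> \<bar>d\<bar>)"])
  show "cellular_automaton f \<in> seq_space m \<rightarrow> seq_space m"
    using range by (simp add: topspace_seq cellular_automaton_def PiE_iff)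
  fix x y :: "int \<Rightarrow> int" and n
  assume xy: "\<And>i. \<bar>i - n\<bar> \<le> int (nat (max \<bar>c\<bar> \<bar>d\<bar>)) \<Longrightarrow> x i = y i"
  show "cellular_automaton f x n = cellular_automaton f y n"
    unfolding cellular_automaton_def by (intro dep xy) linarith
qed

text \<open>The sign \<open>s\<close> selects the direction: the rule reads only positive (\<open>s = 1\<close>) or only negative
  (\<open>s = -1\<close>) offsets.\<close>

lemma strong_mixing_cellular_automaton:
  fixes s :: int
  assumes range: "\<And>y. f y \<in> Zmod m"
    and dep: "\<And>x y. (\<And>i. c \<le> i \<Longrightarrow> i \<le> d \<Longrightarrow> x i = y i) \<Longrightarrow> f x = f y"
    and s: "\<bar>s\<bar> = 1" "\<And>i. c \<le> i \<Longrightarrow> i \<le> d \<Longrightarrow> 0 < s * i"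
    and preserving: "distr M M (cellular_automaton f) = M"
  shows "strong_mixing M (cellular_automaton f)"
proof (rule strong_mixing_if_forgets_windows[OF measurable_cellular_automaton[OF range dep] preserving])
  let ?T = "cellular_automaton f"
  \<comment> \<open>All offsets satisfy \<open>s * j \<ge> 1\<close>, so one step moves the
    half-line that is read by at least one in direction \<open>s\<close>.\<close>
  have step: "?T x i = ?T y i" if "\<And>i. a + 1 \<le> s * i \<Longrightarrow> x i = y i" "a \<le> s * i" for x y a i
    unfolding cellular_automaton_def
  proof (rule dep)
    fix j assume "c \<le> j" "j \<le> d"
    then have "0 < s * j" by (rule s(2))
    then have "a + 1 \<le> s * (i + j)" using that(2) by (simp add: distrib_left)
    then show "x (i + j) = y (i + j)" by (rule that(1))
  qed
  have steps: "(?T ^^ n) x i = (?T ^^ n) y i"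
    if "\<And>i. a + int n \<le> s * i \<Longrightarrow> x i = y i" "a \<le> s * i" for n x y a i
    using that
  proof (induction n arbitrary: a i)
    case (Suc n)
    have "(?T ^^ n) x j = (?T ^^ n) y j" if "a + 1 \<le> s * j" for j
      by (rule Suc.IH[OF _ that]) (rule Suc.prems(1), simp)
    then show ?case unfolding funpow.simps o_apply by (rule step[OF _ Suc.prems(2)])
  qed simp
  fix k l
  show "\<forall>\<^sub>F n in sequentially. \<forall>x\<in>seq_space m. \<forall>y\<in>seq_space m.
      (\<forall>i. \<bar>i\<bar> \<ge> int l \<longrightarrow> x i = y i) \<longrightarrow>
      (\<forall>i. \<bar>i\<bar> < int k \<longrightarrow> (?T ^^ n) x i = (?T ^^ n) y i)"
    \<comment> \<open>After \<open>k + l\<close> steps the half-line read from window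
      \<open>k\<close> starts at \<open>- k + n \<ge> l\<close>, beyond window
      \<open>l\<close>.\<close>
    using eventually_ge_at_top[of "k + l"]
  proof eventually_elim
    case (elim n)
    have abs_s: "\<bar>s * i\<bar> = \<bar>i\<bar>" for i using s(1) by (simp add: abs_mult)
    show ?case
    proof (intro ballI allI impI)
      fix x y :: "int \<Rightarrow> int" and i
      assume "\<forall>i. \<bar>i\<bar> \<ge> int l \<longrightarrow> x i = y i" and i: "\<bar>i\<bar> < int k"
      moreover have "\<bar>j\<bar> \<ge> int l" if "- int k + int n \<le> s * j" for j
        using that elim abs_s[of j] by linarith
      moreover have "- int k \<le> s * i" using i abs_s[of i] by linarith
      ultimately show "(?T ^^ n) x i = (?T ^^ n) y i" by (intro steps[of "- int k"]) auto
    qed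
  qed
qed

end

section \<open>The automaton and its inverse\<close>

theorem theorem4p3:
  fixes p l r :: int and lam :: "int \<Rightarrow> int" and \<mu> :: "(int \<Rightarrow> int) measure"
  defines "T \<equiv> cellular_automaton (linear_rule (p^2) l r lam)"
  assumes "prime p"
    and "0 < l" and "l \<le> r"
    and "\<And>i. i \<in> {l..r} \<Longrightarrow> lam i \<in> Zmod (p^2)"
    and "gcd p (lam r) = 1"
    and "\<And>i. i \<in> {l..r} \<Longrightarrow> i \<noteq> r \<Longrightarrow> p dvd lam i"
    and "uniform_bernoulli (p^2) \<mu>"
  shows "bij_betw T (seq_space (p^2)) (seq_space (p^2)) \<and>
         strong_mixing \<mu> T \<and>
         (\<exists>\<gamma> g. (\<forall>i\<in>{-(2*r-l)..-r}. \<gamma> i \<in> Zmod (p^2)) \<and>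
            g = (\<lambda>y. (- p * (\<Sum>i\<in>{-(2*r-l)..-r}. \<gamma> i * y i)
                      + modular_inverse (p^2) (lam r) * y (-r)) mod p^2) \<and>
            (\<forall>x\<in>seq_space (p^2). cellular_automaton g x = inv_into (seq_space (p^2)) T x) \<and>
            strong_mixing \<mu> (cellular_automaton g))"
proof -
  interpret prob_space \<mu>
    using assms(8) by (simp add: uniform_bernoulli_def)
  interpret uniform_bernoulli_space \<mu> "p\<^sup>2"
    using assms(8) by unfold_locales
  define u where "u = modular_inverse (p\<^sup>2) (lam r)"
  \<comment> \<open>Coefficients of \<open>S\<close>: the divisions are exact for
    \<open>i \<noteq> r\<close>, and the value 0 at \<open>r\<close> leaves that term to the unit
    part.\<close>
  define a where "a i = (if i = r then 0 else lam i div p)" for i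
  \<comment> \<open>Coefficients of \<open>u\<^sup>2 \<sigma>\<^sup>-\<^sup>2\<^sup>r S\<close>:
    adding \<open>2 * r\<close> carries the inverse's window onto \<open>{l..r}\<close>.\<close>
  define \<gamma> where "\<gamma> i = (u\<^sup>2 * a (i + 2 * r)) mod p\<^sup>2" for i
  define g where "g = (\<lambda>y. (- p * (\<Sum>i\<in>{-(2*r-l)..-r}. \<gamma> i * y i) + u * y (-r)) mod p\<^sup>2)"
  define G where "G = cellular_automaton g"
  let ?f = "linear_rule (p\<^sup>2) l r lam"
  let ?S = "\<lambda>x n. \<Sum>i\<in>{l..r}. a i * x (n + i)"
  have "coprime (lam r) (p\<^sup>2)"
    using assms(6) by (simp add: coprime_iff_gcd_eq_1[symmetric] coprime_commute)
  then have uL: "[u * lam r = 1] (mod p\<^sup>2)"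
    unfolding u_def by (rule cong_modular_inverse2)
  have T_cong: "[T x n = lam r * x (n + r) + p * ?S x n] (mod p\<^sup>2)" for x n
  proof -
    have "(\<Sum>i\<in>{l..r}. lam i * x (n + i)) =
        (\<Sum>i\<in>{l..r}. (if i = r then lam r * x (n + r) else 0) + p * (a i * x (n + i)))"
      using assms(7) by (intro sum.cong refl) (auto simp: a_def)
    also have "\<dots> = lam r * x (n + r) + p * ?S x n"
      using \<open>l \<le> r\<close> by (simp add: sum.distrib sum_distrib_left)
    finally show ?thesis
      by (simp add: T_def cellular_automaton_def linear_rule_def cong_def)
  qed
  have G_cong: "[G x n = u * x (n - r) - p * (u\<^sup>2 * ?S x (n - 2 * r))] (mod p\<^sup>2)" for x n
  proof -
    have "(\<Sum>i\<in>{-(2*r-l)..-r}. \<gamma> i * x (n + i)) = (\<Sum>i\<in>{l..r}. \<gamma> (i - 2 * r) * x (n - 2 * r + i))"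
      by (rule sum.reindex_bij_witness[of _ "\<lambda>i. i - 2 * r" "\<lambda>i. i + 2 * r"]) auto
    also have "[\<dots> = (\<Sum>i\<in>{l..r}. u\<^sup>2 * a i * x (n - 2 * r + i))] (mod p\<^sup>2)"
      by (intro cong_sum cong_mult cong_refl) (simp add: \<gamma>_def)
    also have "(\<Sum>i\<in>{l..r}. u\<^sup>2 * a i * x (n - 2 * r + i)) = u\<^sup>2 * ?S x (n - 2 * r)"
      by (simp add: sum_distrib_left mult.assoc)
    finally have "[u * x (n - r) - p * (\<Sum>i\<in>{-(2*r-l)..-r}. \<gamma> i * x (n + i)) =
        u * x (n - r) - p * (u\<^sup>2 * ?S x (n - 2 * r))] (mod p\<^sup>2)"
      by (intro cong_diff cong_mult cong_refl)
    then show ?thesis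
      by (simp add: G_def g_def cellular_automaton_def cong_def)
  qed
  have fZ: "?f y \<in> Zmod (p\<^sup>2)" and gZ: "g y \<in> Zmod (p\<^sup>2)" for y
    using m_pos by (auto simp: linear_rule_def g_def Zmod_def)
  have TG_space: "T x \<in> seq_space (p\<^sup>2)" "G x \<in> seq_space (p\<^sup>2)" for x
    using fZ gZ by (auto simp: T_def G_def cellular_automaton_def topspace_seq)
  \<comment> \<open>Congruent configurations agree because both consist of reduced residues.\<close>
  have eqI: "y = x" if "\<And>n. [y n = x n] (mod p\<^sup>2)" "x \<in> seq_space (p\<^sup>2)" "y \<in> seq_space (p\<^sup>2)" for x y
    using that by (intro ext) (auto simp: cong_def seq_space_iff)
  note inverse = inverse_linear_automaton[OF uL T_cong G_cong]
  have GT: "G (T x) = x" and TG: "T (G x) = x" if "x \<in> seq_space (p\<^sup>2)" for x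
    using inverse that TG_space by (auto intro!: eqI)
  have bij: "bij_betw T (seq_space (p\<^sup>2)) (seq_space (p\<^sup>2))"
    using GT TG TG_space by (intro bij_betwI[where g = G]) auto
  have f_dep: "?f x = ?f y" if "\<And>i. l \<le> i \<Longrightarrow> i \<le> r \<Longrightarrow> x i = y i" for x y
  proof -
    have "(\<Sum>i\<in>{l..r}. lam i * x i) = (\<Sum>i\<in>{l..r}. lam i * y i)"
      using that by (intro sum.cong) auto
    then show ?thesis by (simp add: linear_rule_def)
  qed
  have g_dep: "g x = g y" if "\<And>i. -(2*r-l) \<le> i \<Longrightarrow> i \<le> -r \<Longrightarrow> x i = y i" for x y
  proof -
    have "(\<Sum>i\<in>{-(2*r-l)..-r}. \<gamma> i * x i) = (\<Sum>i\<in>{-(2*r-l)..-r}. \<gamma> i * y i)"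
      using that by (intro sum.cong) auto
    \<comment> \<open>The separate unit term is read inside the window, whose right end is
      \<open>-r\<close>.\<close>
    moreover have "x (-r) = y (-r)" using \<open>l \<le> r\<close> by (intro that) auto
    ultimately show ?thesis by (simp add: g_def)
  qed
  have T_meas: "T \<in> measurable \<mu> \<mu>"
    unfolding T_def by (rule measurable_cellular_automaton[OF fZ f_dep])
  have G_meas: "G \<in> measurable \<mu> \<mu>"
    unfolding G_def by (rule measurable_cellular_automaton[OF gZ g_dep])
  have T_distr: "distr \<mu> \<mu> T = \<mu>"
    using bij T_meas linear_automaton_translate unfolding T_def
    by (intro distr_if_additive) (auto simp: bij_betw_def)
  \<comment> \<open>Invariance passes to the inverse: \<open>\<mu>\<close> is its own image under
    \<open>T\<close>, and applying \<open>G\<close> undoes \<open>T\<close>.\<close>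
  have "distr \<mu> \<mu> G = distr (distr \<mu> \<mu> T) \<mu> G"
    by (simp add: T_distr)
  also have "\<dots> = distr \<mu> \<mu> (G \<circ> T)"
    by (rule distr_distr[OF G_meas T_meas])
  also have "\<dots> = distr \<mu> \<mu> (\<lambda>x. x)"
    by (rule distr_cong) (auto simp: space_M GT)
  finally have G_distr: "distr \<mu> \<mu> G = \<mu>"
    by (simp add: distr_id)
  have "strong_mixing \<mu> T"
    using T_distr \<open>0 < l\<close> unfolding T_def
    by (intro strong_mixing_cellular_automaton[where s = 1, OF fZ f_dep]) auto
  moreover have "strong_mixing \<mu> G"
    using G_distr \<open>0 < l\<close> \<open>l \<le> r\<close> unfolding G_def
    \<comment> \<open>Every offset of \<open>g\<close> is at most \<open>-r < 0\<close>, so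
      information is read from the left.\<close>
    by (intro strong_mixing_cellular_automaton[where s = "-1", OF gZ g_dep]) auto
  moreover have "G x = inv_into (seq_space (p\<^sup>2)) T x" if "x \<in> seq_space (p\<^sup>2)" for x
    using inv_into_f_f[OF bij_betw_imp_inj_on[OF bij] TG_space(2), of x] that by (simp add: TG)
  moreover have "\<gamma> i \<in> Zmod (p\<^sup>2)" for i
    using m_pos by (simp add: \<gamma>_def Zmod_def)
  ultimately show ?thesis
    using bij g_def unfolding G_def u_def by (intro conjI exI[of _ \<gamma>] exI[of _ g]) simp_all
qed

end
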